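(* Let $n\ge 1$, let $\alpha \in S_n$ be a permutation with length $w=l(\alpha)$, and let $T_\alpha\in B_n$ be the simple braid associated to $\alpha$. Then $\partial_v^+(P(\widehat{T_{\alpha}}))=w+n-1$ if and only if $\alpha= \mathrm{id}$. Moreover, for $\alpha=\mathrm{id}$ (so that $w=0$), the coefficient of $v^{w+n-1}$ in $P(\widehat{T_{\mathrm{id}}})$ is $(-z)^{1-n}$.
   Context: $B_n$ is the braid group on $n$ strands with standard generators $\sigma_1,\dots,\sigma_{n-1}$, where $\sigma_i$ is a positive crossing; $\widehat{b}$ denotes the oriented link obtained as the closure of $b\in B_n$. The Homflypt polynomial $P(L)=P_L(v,z)\in\mathbb{Z}[v^{\pm1},z^{\pm1}]$ is the isotopy invariant of oriented links determined by $P(\text{unknot})=1$ and the skein relation $v^{-1}P(L_+)-vP(L_-)=zP(L_0)$, where $L_+,L_-,L_0$ differ only near one crossing, which is respectively positive, negative, and smoothed according to orientation. For braids this reads $v^{-1}\sigma_i-v\sigma_i^{-1}=z$, i.e. $\sigma_i^2=vz\sigma_i+v^2$. $\partial_v^+(P(L))$ denotes the highest $v$-degree of $P(L)$; coefficients of powers of $v$ are Laurent polynomials in $z$. For $\alpha\in S_n$, the simple braid $T_\alpha$ (also called positive permutation braid) is the unique positive braid in $B_n$ which induces the permutation $\alpha$ on its endpoints and such that every two strands cross at most once; equivalently, if $\alpha=s_{i_1}\cdots s_{i_k}$ is a reduced expression in the transpositions $s_i=(i\ i+1)$, then $T_\alpha=\sigma_{i_1}\cdots\sigma_{i_k}$.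 The length $l(\alpha)$ is the length $k$ of a reduced expression; $T_{\mathrm{id}}$ is the identity braid. *)

theory Defs
  imports
    Complex_Main
    "HOL-Library.Poly_Mapping"
    "HOL-Library.Extended"
    "HOL-Combinatorics.Permutations"
begin

section \<open>Laurent polynomials in \<open>v\<close> and \<open>z\<close>\<close>

text \<open>The group ring of the integers with integer coefficients is the ring of Laurent
  polynomials in \<open>z\<close>; the group ring of the integers over that ring is the ring of Laurent
  polynomials in \<open>v\<close> and \<open>z\<close>.\<close>

type_synonym zlaurent = "int \<Rightarrow>\<^sub>0 int"
type_synonym laurent = "int \<Rightarrow>\<^sub>0 zlaurent"

definition z_power :: "int \<Rightarrow> zlaurent" where
  "z_power k = Poly_Mapping.single k 1"

definition v_power :: "int \<Rightarrow> laurent" where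
  "v_power k = Poly_Mapping.single k 1"

definition const_v :: "zlaurent \<Rightarrow> laurent" where
  "const_v c = Poly_Mapping.single 0 c"

definition v_coeff :: "laurent \<Rightarrow> int \<Rightarrow> zlaurent" where
  "v_coeff p k = Poly_Mapping.lookup p k"

definition max_v_degree :: "laurent \<Rightarrow> int extended" where
  "max_v_degree p = (if p = 0 then Minf else Fin (Max (Poly_Mapping.keys p)))"


section \<open>Oriented link diagrams\<close>

text \<open>A generic oriented diagram in the plane is cut along horizontal lines into layers, each
  containing one local minimum (cup), one local maximum (cap) or one crossing. It is recorded as
  the list of its layers, from bottom to top; the number attached to a layer counts the vertical
  strands to the left of its cup, cap or crossing.

  \<open>Cup d\<close> creates two strands, the left one directed by \<open>d\<close> and the right one oppositely.
  In \<open>Cross s\<close>, the strand from bottom left to top right is the overpass iff \<open>s\<close> holds.\<close>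

datatype dir = Up | Down

fun opp :: "dir \<Rightarrow> dir" where
  "opp Up = Down"
| "opp Down = Up"

datatype elem = Cup dir | Cap | Cross bool

type_synonym layer = "nat \<times> elem"
type_synonym diagram = "layer list"

text \<open>In \<open>attaches ds l es\<close> and \<open>tangle ds D es\<close>, the lists \<open>ds\<close> and \<open>es\<close> give the directions
  of the strands at the bottom and at the top, from left to right.\<close>

inductive attaches :: "dir list \<Rightarrow> layer \<Rightarrow> dir list \<Rightarrow> bool" where
  cup: "attaches (xs @ ys) (length xs, Cup d) (xs @ [d, opp d] @ ys)"
| cap: "attaches (xs @ [d, opp d] @ ys) (length xs, Cap) (xs @ ys)"
| cross: "attaches (xs @ [d, e] @ ys) (length xs, Cross s) (xs @ [e, d] @ ys)"

inductive tangle :: "dir list \<Rightarrow> diagram \<Rightarrow> dir list \<Rightarrow> bool" where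
  nil: "tangle ds [] ds"
| cons: "attaches ds l es \<Longrightarrow> tangle es D fs \<Longrightarrow> tangle ds (l # D) fs"

definition link_diagram :: "diagram \<Rightarrow> bool" where
  "link_diagram D \<longleftrightarrow> tangle [] D []"

definition unknot :: diagram where
  "unknot = [(0, Cup Up), (0, Cap)]"


section \<open>Isotopy\<close>

fun bottom_ends :: "elem \<Rightarrow> nat" where
  "bottom_ends (Cup d) = 0"
| "bottom_ends Cap = 2"
| "bottom_ends (Cross s) = 2"

fun top_ends :: "elem \<Rightarrow> nat" where
  "top_ends (Cup d) = 2"
| "top_ends Cap = 0"
| "top_ends (Cross s) = 2"

text \<open>The rules \<open>exchange\<close>, \<open>straighten_left\<close>, \<open>straighten_right\<close>, \<open>slide_cup\<close> and
  \<open>slide_cap\<close> generate planar isotopy of diagrams cut into layers; the others are the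
  Reidemeister moves. In \<open>slide_cup\<close> and \<open>slide_cap\<close> a strand passing over (or under) one leg
  of a cup or cap is moved to the other leg, which makes it lean the other way and so negates
  the Boolean of the crossing. In \<open>reidemeister3\<close>, the Booleans \<open>a\<close>, \<open>b\<close>, \<open>c\<close> belong to the
  pairs of strands (1,2), (1,3), (2,3), numbered from the left at the bottom; the condition
  excludes the two cyclic patterns, in which no strand lies above both others.\<close>

inductive local_move :: "diagram \<Rightarrow> diagram \<Rightarrow> bool" where
  exchange: "k \<le> j \<Longrightarrow>
    local_move [(k, g), (j + top_ends g, h)] [(j + bottom_ends g, h), (k, g)]"
| straighten_left: "local_move [(k, Cup d), (Suc k, Cap)] []"
| straighten_right: "local_move [(Suc k, Cup d), (k, Cap)] []"
| slide_cup: "local_move [(Suc k, Cup d), (k, Cross s)] [(k, Cup d), (Suc k, Cross (\<not> s))]"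
| slide_cap: "local_move [(k, Cross s), (Suc k, Cap)] [(Suc k, Cross (\<not> s)), (k, Cap)]"
| reidemeister1_cup: "local_move [(k, Cup d), (k, Cross s)] [(k, Cup (opp d))]"
| reidemeister1_cap: "local_move [(k, Cross s), (k, Cap)] [(k, Cap)]"
| reidemeister2: "local_move [(k, Cross s), (k, Cross (\<not> s))] []"
| reidemeister3: "a = b \<or> b = c \<Longrightarrow>
    local_move [(k, Cross a), (Suc k, Cross b), (k, Cross c)]
               [(Suc k, Cross c), (k, Cross b), (Suc k, Cross a)]"

inductive move :: "diagram \<Rightarrow> diagram \<Rightarrow> bool" where
  "local_move A B \<Longrightarrow> link_diagram (D @ A @ E) \<Longrightarrow> link_diagram (D @ B @ E) \<Longrightarrow>
    move (D @ A @ E) (D @ B @ E)"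

definition isotopic :: "diagram \<Rightarrow> diagram \<Rightarrow> bool" where
  "isotopic = equivclp move"


section \<open>The Homflypt polynomial\<close>

text \<open>If the strands entering a crossing from below have directions \<open>d\<close> (left) and \<open>e\<close>
  (right), then for \<open>d = e\<close> the crossing is positive iff its strand from bottom left to top right
  is the overpass, and for \<open>d \<noteq> e\<close> it is positive iff that strand is the underpass.
  The smoothing respecting the orientation is vertical in the first case and a cap below a cup in
  the second.\<close>

definition smoothing :: "nat \<Rightarrow> dir \<Rightarrow> dir \<Rightarrow> diagram" where
  "smoothing k d e = (if d = e then [] else [(k, Cap), (k, Cup e)])"

inductive skein_triple :: "diagram \<Rightarrow> diagram \<Rightarrow> diagram \<Rightarrow> bool" where
  "tangle [] D (xs @ [d, e] @ ys) \<Longrightarrow> tangle (xs @ [e, d] @ ys) E [] \<Longrightarrow> k = length xs \<Longrightarrow>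
    skein_triple (D @ [(k, Cross (d = e))] @ E)
                 (D @ [(k, Cross (d \<noteq> e))] @ E)
                 (D @ smoothing k d e @ E)"

definition homflypt :: "(diagram \<Rightarrow> laurent) \<Rightarrow> bool" where
  "homflypt P \<longleftrightarrow>
    (\<forall>D D'. isotopic D D' \<longrightarrow> P D = P D') \<and>
    P unknot = 1 \<and>
    (\<forall>Lp Lm L0. skein_triple Lp Lm L0 \<longrightarrow>
      v_power (-1) * P Lp - v_power 1 * P Lm = const_v (z_power 1) * P L0)"


section \<open>Braids and their closures\<close>

text \<open>A braid on \<open>n\<close> strands is given by a word, in which \<open>(i, True)\<close> stands for
  \<open>\<sigma>\<^sub>i\<close> and \<open>(i, False)\<close> for its inverse, with \<open>1 \<le> i < n\<close>. The braid group is the set of words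
  modulo \<open>braid_equiv n\<close>.\<close>

type_synonym braid_word = "(nat \<times> bool) list"

definition braid_words :: "nat \<Rightarrow> braid_word set" where
  "braid_words n = {b. \<forall>(i, s) \<in> set b. 1 \<le> i \<and> i < n}"

inductive braid_relation :: "braid_word \<Rightarrow> braid_word \<Rightarrow> bool" where
  inverse: "braid_relation [(i, s), (i, \<not> s)] []"
| commute: "i + 2 \<le> j \<Longrightarrow> braid_relation [(i, True), (j, True)] [(j, True), (i, True)]"
| braid: "braid_relation [(i, True), (Suc i, True), (i, True)]
                         [(Suc i, True), (i, True), (Suc i, True)]"

inductive braid_step :: "nat \<Rightarrow> braid_word \<Rightarrow> braid_word \<Rightarrow> bool" for n where
  "braid_relation a b \<Longrightarrow> c @ a @ d \<in> braid_words n \<Longrightarrow> c @ b @ d \<in> braid_words n \<Longrightarrow>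
    braid_step n (c @ a @ d) (c @ b @ d)"

definition braid_equiv :: "nat \<Rightarrow> braid_word \<Rightarrow> braid_word \<Rightarrow> bool" where
  "braid_equiv n = equivclp (braid_step n)"

text \<open>The strands of the braid are directed upwards and closed up on its right-hand side by
  nested arcs. A layer counts the strands to its left, so \<open>\<sigma>\<^sub>i\<close> has offset \<open>i - 1\<close>.\<close>

definition closure_diagram :: "nat \<Rightarrow> braid_word \<Rightarrow> diagram" where
  "closure_diagram n b =
    map (\<lambda>k. (k, Cup Up)) [0..<n] @
    map (\<lambda>(i, s). (i - 1, Cross s)) b @
    map (\<lambda>k. (k, Cap)) (rev [0..<n])"


section \<open>Simple braids\<close>

text \<open>The list \<open>[i\<^sub>1, \<dots>, i\<^sub>k]\<close> stands for the product of the transpositions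
  \<open>s\<^sub>i = (i i+1)\<close> for \<open>i = i\<^sub>1, \<dots>, i\<^sub>k\<close>.\<close>

definition transposition_product :: "nat list \<Rightarrow> nat \<Rightarrow> nat" where
  "transposition_product js = foldr (\<lambda>i \<pi>. transpose i (Suc i) \<circ> \<pi>) js id"

definition expression :: "nat \<Rightarrow> (nat \<Rightarrow> nat) \<Rightarrow> nat list \<Rightarrow> bool" where
  "expression n \<alpha> js \<longleftrightarrow> set js \<subseteq> {1..<n} \<and> transposition_product js = \<alpha>"

definition perm_length :: "nat \<Rightarrow> (nat \<Rightarrow> nat) \<Rightarrow> nat" where
  "perm_length n \<alpha> = (LEAST k. \<exists>js. expression n \<alpha> js \<and> length js = k)"

definition reduced_expression :: "nat \<Rightarrow> (nat \<Rightarrow> nat) \<Rightarrow> nat list \<Rightarrow> bool" where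
  "reduced_expression n \<alpha> js \<longleftrightarrow> expression n \<alpha> js \<and> length js = perm_length n \<alpha>"

text \<open>The simple braid of \<open>\<alpha>\<close> as an element of the braid group, that is, as the class of all
  words representing it. It is a single class, since reduced expressions of the same permutation
  give equivalent positive words.\<close>

definition simple_braid :: "nat \<Rightarrow> (nat \<Rightarrow> nat) \<Rightarrow> braid_word set" where
  "simple_braid n \<alpha> =
    {b. \<exists>js. reduced_expression n \<alpha> js \<and> braid_equiv n (map (\<lambda>i. (i, True)) js) b}"

end

theory Submission
  imports Defs
begin

text \<open>Write \<open>f n b\<close> for the Homflypt polynomial of the closure of a braid word \<open>b\<close> on \<open>n\<close> strands.
  Everything follows from four properties of \<open>f\<close>: it depends only on the braid
  (\<open>closure_value_braid_equiv\<close>), it is invariant under conjugation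
  (\<open>closure_value_conjugate\<close>) and under removal of a last strand that meets a single crossing
  (\<open>closure_value_destabilise\<close>), and it satisfies the skein relation. The last two show that a
  last strand without crossings contributes the factor \<open>(v\<inverse> - v) z\<inverse>\<close>, whose leading term is
  \<open>- v z\<inverse>\<close>. For the identity braid this happens \<open>n - 1\<close> times, which gives degree \<open>n - 1\<close> and the
  coefficient \<open>(-z)\<close> to the power \<open>1 - n\<close>.

  For other simple braids the degree has to be bounded. Up to positive braid relations, a positive
  word on \<open>n + 1\<close> strands contains a square \<open>\<sigma>\<^sub>i \<sigma>\<^sub>i\<close>, or else its last generator \<open>\<sigma>\<^sub>n\<close> occurs at
  most once (\<open>square_or_few_top_letters\<close>). In the first case the quadratic relation
  \<open>\<sigma>\<^sub>i \<sigma>\<^sub>i = v\<^sup>2 + v z \<sigma>\<^sub>i\<close> trades length for powers of \<open>v\<close> at an even rate. If \<open>\<sigma>\<^sub>n\<close> does not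
  occur, the last strand splits off and raises the degree by at most one. If it occurs once, it
  can be rotated to the end of the word and removed; then length and number of strands both drop
  by one. Hence the degree of \<open>f n u\<close> is at most \<open>l(u) + n - 1\<close> for every positive word \<open>u\<close>
  (\<open>v_degree_positive_closure\<close>). The removal of a single \<open>\<sigma>\<^sub>n\<close> leaves the degree of \<open>f\<close> unchanged
  but lowers this bound by two, so equality is lost once it happens. In a word
  that is not equivalent to one containing a square, as is every reduced word, only the last two
  cases occur; a nonempty such word must therefore meet the third one
  (\<open>v_degree_square_free_closure\<close>).\<close>


section \<open>Local moves preserve the boundary of a tangle\<close>

lemma tangle_Nil_iff [simp]: "tangle ds [] es \<longleftrightarrow> ds = es"
  by (auto intro: tangle.nil elim: tangle.cases)

lemma tangle_Cons_iff: "tangle ds (l # D) fs \<longleftrightarrow> (\<exists>es. attaches ds l es \<and> tangle es D fs)"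
  by (auto intro: tangle.cons elim: tangle.cases)

lemma tangle_append_iff: "tangle ds (A @ B) fs \<longleftrightarrow> (\<exists>es. tangle ds A es \<and> tangle es B fs)"
  by (induction A arbitrary: ds) (auto simp: tangle_Cons_iff)

text \<open>The directions of the bottom and of the top ends of an elementary piece. It lets cups, caps
  and crossings be treated alike in the exchange move.\<close>
fun boundary :: "elem \<Rightarrow> dir list \<Rightarrow> dir list \<Rightarrow> bool" where
  "boundary (Cup d) as bs \<longleftrightarrow> as = [] \<and> bs = [d, opp d]"
| "boundary Cap as bs \<longleftrightarrow> (\<exists>d. as = [d, opp d]) \<and> bs = []"
| "boundary (Cross s) as bs \<longleftrightarrow> (\<exists>d e. as = [d, e] \<and> bs = [e, d])"

lemma attaches_iff:
  "attaches ds (k, g) es \<longleftrightarrow>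
    (\<exists>xs as bs ys. ds = xs @ as @ ys \<and> es = xs @ bs @ ys \<and> length xs = k \<and> boundary g as bs)"
(is "?L \<longleftrightarrow> ?R")
proof
  assume ?L
  then show ?R
  proof (cases rule: attaches.cases)
    case (cup xs ys d)
    then show ?thesis by (intro exI[of _ xs] exI[of _ "[]"] exI[of _ "[d, opp d]"] exI[of _ ys]) auto
  next
    case (cap xs d ys)
    then show ?thesis by (intro exI[of _ xs] exI[of _ "[d, opp d]"] exI[of _ "[]"] exI[of _ ys]) auto
  next
    case (cross xs d e ys s)
    then show ?thesis by (intro exI[of _ xs] exI[of _ "[d, e]"] exI[of _ "[e, d]"] exI[of _ ys]) auto
  qed
next
  assume ?R
  then obtain xs as bs ys where eqs: "ds = xs @ as @ ys" "es = xs @ bs @ ys" "k = length xs"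
    and bd: "boundary g as bs"
    by blast
  show ?L
  proof (cases g)
    case (Cup d)
    then show ?thesis using bd attaches.cup[of xs ys d] by (simp add: eqs)
  next
    case Cap
    then obtain d where "as = [d, opp d]" "bs = []" using bd by auto
    then show ?thesis using Cap attaches.cap[of xs d ys] by (simp add: eqs)
  next
    case (Cross s)
    then obtain d e where "as = [d, e]" "bs = [e, d]" using bd by auto
    then show ?thesis using Cross attaches.cross[of xs d e ys s] by (simp add: eqs)
  qed
qed

lemma boundary_length: "boundary g as bs \<Longrightarrow> length as = bottom_ends g \<and> length bs = top_ends g"
  by (cases g) auto

lemma attachesE:
  assumes "attaches ds (k, g) es"
  obtains xs as bs ys where "ds = xs @ as @ ys" "es = xs @ bs @ ys" "length xs = k" "boundary g as bs"
  using assms unfolding attaches_iff by blast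

lemma attachesI:
  "boundary g as bs \<Longrightarrow> length xs = k \<Longrightarrow> attaches (xs @ as @ ys) (k, g) (xs @ bs @ ys)"
  unfolding attaches_iff by blast

lemma append_eq_append_split:
  assumes "xs @ ys = xs' @ ys'" "length xs \<le> length xs'"
  obtains us where "xs' = xs @ us" "ys = us @ ys'"
proof -
  from assms(1) obtain us where "(xs = xs' @ us \<and> us @ ys = ys') \<or> (xs @ us = xs' \<and> ys = us @ ys')"
    unfolding append_eq_append_conv2 by blast
  with assms(2) show ?thesis using that by fastforce
qed

text \<open>The two pieces have disjoint supports: the second one lies in the list of strands to the right
  of the first one, which the first one does not change.\<close>
lemma tangle_exchange:
  assumes "k \<le> j"
  shows "tangle ds [(k, g), (j + top_ends g, h)] es \<longleftrightarrow> tangle ds [(j + bottom_ends g, h), (k, g)] es"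
    (is "?L \<longleftrightarrow> ?R")
proof
  assume ?L
  then obtain fs where fs: "attaches ds (k, g) fs" "attaches fs (j + top_ends g, h) es"
    by (auto simp: tangle_Cons_iff)
  from fs(1) obtain xs as bs ys where
    1: "ds = xs @ as @ ys" "fs = xs @ bs @ ys" "length xs = k" "boundary g as bs"
    by (rule attachesE)
  from fs(2) obtain xs' as' bs' ys' where
    2: "fs = xs' @ as' @ ys'" "es = xs' @ bs' @ ys'" "length xs' = j + top_ends g" "boundary h as' bs'"
    by (rule attachesE)
  have eq: "(xs @ bs) @ ys = xs' @ (as' @ ys')" using 1(2) 2(1) by simp
  have "length (xs @ bs) \<le> length xs'"
    using 1(3) 2(3) boundary_length[OF 1(4)] assms by simp
  with eq obtain us where us: "xs' = (xs @ bs) @ us" "ys = us @ (as' @ ys')"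
    by (rule append_eq_append_split)
  have "length (xs @ as @ us) = j + bottom_ends g"
    using us(1) 1(3) 2(3) boundary_length[OF 1(4)] by simp
  from attachesI[OF 2(4) this, of ys']
  have "attaches ds (j + bottom_ends g, h) (xs @ as @ us @ bs' @ ys')" by (simp add: 1(1) us(2))
  moreover from attachesI[OF 1(4,3), of "us @ bs' @ ys'"]
  have "attaches (xs @ as @ us @ bs' @ ys') (k, g) es" by (simp add: 2(2) us(1))
  ultimately show ?R by (auto simp: tangle_Cons_iff)
next
  assume ?R
  then obtain fs where fs: "attaches ds (j + bottom_ends g, h) fs" "attaches fs (k, g) es"
    by (auto simp: tangle_Cons_iff)
  from fs(1) obtain xs' as' bs' ys' where
    2: "ds = xs' @ as' @ ys'" "fs = xs' @ bs' @ ys'" "length xs' = j + bottom_ends g" "boundary h as' bs'"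
    by (rule attachesE)
  from fs(2) obtain xs as bs ys where
    1: "fs = xs @ as @ ys" "es = xs @ bs @ ys" "length xs = k" "boundary g as bs"
    by (rule attachesE)
  have eq: "(xs @ as) @ ys = xs' @ (bs' @ ys')" using 1(1) 2(2) by simp
  have "length (xs @ as) \<le> length xs'"
    using 1(3) 2(3) boundary_length[OF 1(4)] assms by simp
  with eq obtain us where us: "xs' = (xs @ as) @ us" "ys = us @ (bs' @ ys')"
    by (rule append_eq_append_split)
  have "length (xs @ bs @ us) = j + top_ends g"
    using us(1) 1(3) 2(3) boundary_length[OF 1(4)] by simp
  from attachesI[OF 2(4) this, of ys']
  have "attaches (xs @ bs @ us @ as' @ ys') (j + top_ends g, h) es" by (simp add: 1(2) us(2))
  moreover from attachesI[OF 1(4,3), of "us @ as' @ ys'"]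
  have "attaches ds (k, g) (xs @ bs @ us @ as' @ ys')" by (simp add: 2(1) us(1))
  ultimately show ?L by (auto simp: tangle_Cons_iff)
qed

lemma opp_opp [simp]: "opp (opp d) = d" by (cases d) auto

text \<open>Together with the next lemma, this evaluates tangles at concrete offsets by the simplifier. The
  moves at an arbitrary offset reduce to offset \<open>0\<close> because the strands to the left pass through
  unchanged.\<close>
lemma attaches_0_iff:
  "attaches ds (0, Cup d) es \<longleftrightarrow> es = d # opp d # ds"
  "attaches ds (0, Cap) es \<longleftrightarrow> (\<exists>d. ds = d # opp d # es)"
  "attaches ds (0, Cross s) es \<longleftrightarrow> (\<exists>d e ys. ds = d # e # ys \<and> es = e # d # ys)"
  using attaches.cup[of "[]"] attaches.cap[of "[]"] attaches.cross[of "[]"]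
  by (auto elim: attaches.cases)

lemma attaches_Suc_iff:
  "attaches ds (Suc k, g) es \<longleftrightarrow>
    (\<exists>x ds' es'. ds = x # ds' \<and> es = x # es' \<and> attaches ds' (k, g) es')"
proof
  assume "attaches ds (Suc k, g) es"
  then obtain xs as bs ys
    where "ds = xs @ as @ ys" "es = xs @ bs @ ys" and len: "length xs = Suc k" and "boundary g as bs"
    by (rule attachesE)
  moreover from len obtain x xs' where "xs = x # xs'" by (cases xs) auto
  ultimately show "\<exists>x ds' es'. ds = x # ds' \<and> es = x # es' \<and> attaches ds' (k, g) es'"
    using attachesI[of g as bs xs' k ys] by simp
next
  assume "\<exists>x ds' es'. ds = x # ds' \<and> es = x # es' \<and> attaches ds' (k, g) es'"
  then obtain x ds' es' where x: "ds = x # ds'" "es = x # es'" and "attaches ds' (k, g) es'" by blast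
  from this(3) obtain xs as bs ys
    where "ds' = xs @ as @ ys" "es' = xs @ bs @ ys" "length xs = k" "boundary g as bs"
    by (rule attachesE)
  then show "attaches ds (Suc k, g) es"
    using x attachesI[of g as bs "x # xs" "Suc k" ys] by simp
qed

definition shift :: "nat \<Rightarrow> diagram \<Rightarrow> diagram" where
  "shift k D = map (\<lambda>(i, g). (k + i, g)) D"

lemma tangle_shift_Suc_iff:
  "D \<noteq> [] \<Longrightarrow> tangle ds (shift (Suc k) D) es \<longleftrightarrow>
    (\<exists>x ds' es'. ds = x # ds' \<and> es = x # es' \<and> tangle ds' (shift k D) es')"
proof (induction D arbitrary: ds)
  case (Cons l D)
  obtain i g where l: "l = (i, g)" by (cases l)
  show ?case
  proof (cases "D = []")
    case True
    then show ?thesis by (auto simp: shift_def l tangle_Cons_iff attaches_Suc_iff)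
  next
    case False
    then show ?thesis using Cons.IH
      by (auto simp: shift_def l tangle_Cons_iff attaches_Suc_iff)
  qed
qed simp

lemma tangle_shift_cong:
  assumes "\<And>ds es. tangle ds A es \<longleftrightarrow> tangle ds B es" "A \<noteq> []" "B \<noteq> []"
  shows "tangle ds (shift k A) es \<longleftrightarrow> tangle ds (shift k B) es"
proof (induction k arbitrary: ds es)
  case 0
  show ?case using assms(1) by (simp add: shift_def)
next
  case (Suc k)
  show ?case using Suc assms(2,3) by (simp add: tangle_shift_Suc_iff)
qed

lemma tangle_shift_imp:
  assumes "\<And>ds es. tangle ds A es \<Longrightarrow> ds = es" "A \<noteq> []"
  shows "tangle ds (shift k A) es \<Longrightarrow> ds = es"
proof (induction k arbitrary: ds es)
  case 0
  then show ?case using assms(1) by (simp add: shift_def)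
next
  case (Suc k)
  then show ?case using assms(2) by (auto simp: tangle_shift_Suc_iff)
qed

text \<open>Only the moves that create pieces out of nothing need the presence of suitable strands; the others
  preserve the boundary in both directions.\<close>
lemma tangle_move_iff:
  assumes "local_move A B" "B \<noteq> []"
  shows "tangle ds A es \<longleftrightarrow> tangle ds B es"
proof -
  note layers = tangle_Cons_iff attaches_0_iff attaches_Suc_iff
  from assms show ?thesis
  proof (cases rule: local_move.cases)
    case (exchange k j g h)
    then show ?thesis using tangle_exchange by simp
  next
    case (slide_cup k d s)
    have "tangle ds (shift k [(1, Cup d), (0, Cross s)]) es
        \<longleftrightarrow> tangle ds (shift k [(0, Cup d), (1, Cross (\<not> s))]) es"
      by (rule tangle_shift_cong) (auto simp: layers)
    then show ?thesis by (simp add: slide_cup shift_def)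
  next
    case (slide_cap k s)
    have "tangle ds (shift k [(0, Cross s), (1, Cap)]) es
        \<longleftrightarrow> tangle ds (shift k [(1, Cross (\<not> s)), (0, Cap)]) es"
      by (rule tangle_shift_cong) (auto simp: layers)
    then show ?thesis by (simp add: slide_cap shift_def)
  next
    case (reidemeister1_cup k d s)
    have "tangle ds (shift k [(0, Cup d), (0, Cross s)]) es
        \<longleftrightarrow> tangle ds (shift k [(0, Cup (opp d))]) es"
      by (rule tangle_shift_cong) (auto simp: layers)
    then show ?thesis by (simp add: reidemeister1_cup shift_def)
  next
    case (reidemeister1_cap k s)
    have "tangle ds (shift k [(0, Cross s), (0, Cap)]) es \<longleftrightarrow> tangle ds (shift k [(0, Cap)]) es"
    proof (rule tangle_shift_cong)
      show "tangle ds [(0, Cross s), (0, Cap)] es \<longleftrightarrow> tangle ds [(0, Cap)] es" for ds es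
        by (auto simp: layers)
    qed auto
    then show ?thesis by (simp add: reidemeister1_cap shift_def)
  next
    case (reidemeister3 a b c k)
    have "tangle ds (shift k [(0, Cross a), (1, Cross b), (0, Cross c)]) es
        \<longleftrightarrow> tangle ds (shift k [(1, Cross c), (0, Cross b), (1, Cross a)]) es"
      by (rule tangle_shift_cong) (auto simp: layers)
    then show ?thesis by (simp add: reidemeister3 shift_def)
  qed auto
qed

lemma tangle_cancel:
  assumes "local_move A []" "tangle ds A es"
  shows "ds = es"
proof -
  note layers = tangle_Cons_iff attaches_0_iff attaches_Suc_iff
  from assms(1) show ?thesis
  proof (cases rule: local_move.cases)
    case (straighten_left k d)
    have "tangle ds (shift k [(0, Cup d), (1, Cap)]) es \<Longrightarrow> ds = es"
      by (rule tangle_shift_imp) (auto simp: layers)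
    then show ?thesis using assms(2) by (simp add: straighten_left shift_def)
  next
    case (straighten_right k d)
    have "tangle ds (shift k [(1, Cup d), (0, Cap)]) es \<Longrightarrow> ds = es"
      by (rule tangle_shift_imp) (auto simp: layers)
    then show ?thesis using assms(2) by (simp add: straighten_right shift_def)
  next
    case (reidemeister2 k s)
    have "tangle ds (shift k [(0, Cross s), (0, Cross (\<not> s))]) es \<Longrightarrow> ds = es"
      by (rule tangle_shift_imp) (auto simp: layers)
    then show ?thesis using assms(2) by (simp add: reidemeister2 shift_def)
  qed
qed

lemma tangle_move:
  assumes "local_move A B" "tangle ds A es"
  shows "tangle ds B es"
  using assms tangle_cancel tangle_move_iff by (cases "B = []") auto

section \<open>Deformations of parts of a diagram\<close>

text \<open>A part of a diagram may be replaced by another one wherever this part occurs. The existence of a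
  link diagram is required of the source only, and thus need not be proved again after
  each step of a chain of moves.\<close>
definition deforms :: "diagram \<Rightarrow> diagram \<Rightarrow> bool" where
  "deforms A B \<longleftrightarrow> (\<forall>D E. link_diagram (D @ A @ E) \<longrightarrow>
    link_diagram (D @ B @ E) \<and> isotopic (D @ A @ E) (D @ B @ E))"

lemma deforms_refl [simp]: "deforms A A"
  by (simp add: deforms_def isotopic_def)

lemma isotopic_trans: "isotopic A B \<Longrightarrow> isotopic B C \<Longrightarrow> isotopic A C"
  unfolding isotopic_def by (rule equivclp_trans)

lemma deforms_trans [trans]: "deforms A B \<Longrightarrow> deforms B C \<Longrightarrow> deforms A C"
  unfolding deforms_def by (meson isotopic_trans)

lemma deforms_context:
  assumes "deforms A B"
  shows "deforms (X @ A @ Y) (X @ B @ Y)"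
  unfolding deforms_def
proof (intro allI impI)
  fix D E
  assume "link_diagram (D @ (X @ A @ Y) @ E)"
  then have "link_diagram ((D @ X) @ A @ (Y @ E))" by simp
  then have "link_diagram ((D @ X) @ B @ (Y @ E)) \<and>
      isotopic ((D @ X) @ A @ (Y @ E)) ((D @ X) @ B @ (Y @ E))"
    using assms unfolding deforms_def by blast
  then show "link_diagram (D @ (X @ B @ Y) @ E) \<and>
      isotopic (D @ (X @ A @ Y) @ E) (D @ (X @ B @ Y) @ E)" by simp
qed

lemma link_diagram_mono:
  "(\<And>ds es. tangle ds A es \<Longrightarrow> tangle ds B es) \<Longrightarrow>
    link_diagram (D @ A @ E) \<Longrightarrow> link_diagram (D @ B @ E)"
  unfolding link_diagram_def tangle_append_iff by blast

lemma isotopic_move: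
  "local_move A B \<Longrightarrow> link_diagram (D @ A @ E) \<Longrightarrow> link_diagram (D @ B @ E) \<Longrightarrow>
    isotopic (D @ A @ E) (D @ B @ E)"
  unfolding isotopic_def by (blast intro: move.intros)

lemma isotopic_sym: "isotopic A B \<Longrightarrow> isotopic B A"
  unfolding isotopic_def by (rule equivclp_sym)

lemma deforms_move: "local_move A B \<Longrightarrow> deforms A B"
  unfolding deforms_def
  using link_diagram_mono[of A B] tangle_move isotopic_move by blast

lemma deforms_move_reverse: "local_move A B \<Longrightarrow> B \<noteq> [] \<Longrightarrow> deforms B A"
  unfolding deforms_def
  using link_diagram_mono[of B A] tangle_move_iff isotopic_move isotopic_sym by blast

lemma deforms_append: "deforms A B \<Longrightarrow> deforms (X @ A) (X @ B)"
  using deforms_context[of A B X "[]"] by simp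

lemma deforms_prepend: "deforms A B \<Longrightarrow> deforms (A @ Y) (B @ Y)"
  using deforms_context[of A B "[]" Y] by simp

lemma deforms_Cons: "deforms A B \<Longrightarrow> deforms (l # A) (l # B)"
  using deforms_append[of A B "[l]"] by simp

section \<open>Markov moves on closures of braids\<close>

definition cups :: "nat \<Rightarrow> diagram" where
  "cups n = map (\<lambda>k. (k, Cup Up)) [0..<n]"

definition caps :: "nat \<Rightarrow> diagram" where
  "caps n = map (\<lambda>k. (k, Cap)) (rev [0..<n])"

definition crossings :: "braid_word \<Rightarrow> diagram" where
  "crossings b = map (\<lambda>(i, s). (i - 1, Cross s)) b"

lemma closure_diagram_eq: "closure_diagram n b = cups n @ crossings b @ caps n"
  by (simp add: closure_diagram_def cups_def caps_def crossings_def)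

lemma cups_Suc: "cups (Suc n) = cups n @ [(n, Cup Up)]"
  by (simp add: cups_def)

lemma caps_Suc: "caps (Suc n) = (n, Cap) # caps n"
  by (simp add: caps_def)

lemma crossings_simps [simp]:
  "crossings [] = []"
  "crossings ((i, s) # b) = (i - 1, Cross s) # crossings b"
  "crossings (a @ b) = crossings a @ crossings b"
  by (simp_all add: crossings_def)

lemma braid_words_simps [simp]:
  "[] \<in> braid_words n"
  "(i, s) # b \<in> braid_words n \<longleftrightarrow> 1 \<le> i \<and> i < n \<and> b \<in> braid_words n"
  "a @ b \<in> braid_words n \<longleftrightarrow> a \<in> braid_words n \<and> b \<in> braid_words n"
  by (auto simp: braid_words_def)

text \<open>The exchange move measures the offset of the right-hand piece from the top of the left-hand one,
  so its parameter here is \<open>j - 2\<close>.\<close>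
lemma deforms_swap_crossings:
  assumes "i + 2 \<le> j"
  shows "deforms [(i, Cross s), (j, Cross t)] [(j, Cross t), (i, Cross s)]"
    and "deforms [(j, Cross t), (i, Cross s)] [(i, Cross s), (j, Cross t)]"
proof -
  have "local_move [(i, Cross s), (j - 2 + top_ends (Cross s), Cross t)]
      [(j - 2 + bottom_ends (Cross s), Cross t), (i, Cross s)]"
    by (rule local_move.exchange) (use assms in simp)
  moreover have "Suc (Suc (j - 2)) = j" using assms by simp
  ultimately have "local_move [(i, Cross s), (j, Cross t)] [(j, Cross t), (i, Cross s)]"
    by simp
  then show "deforms [(i, Cross s), (j, Cross t)] [(j, Cross t), (i, Cross s)]"
    and "deforms [(j, Cross t), (i, Cross s)] [(i, Cross s), (j, Cross t)]"
    by (auto intro: deforms_move deforms_move_reverse)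
qed

lemma deforms_cup_past_crossings:
  assumes "b \<in> braid_words n"
  shows "deforms ((n, Cup d) # crossings b) (crossings b @ [(n, Cup d)])"
  using assms
proof (induction b)
  case (Cons l b)
  obtain i s where l: "l = (i, s)" by (cases l)
  with Cons.prems have i: "1 \<le> i" "i < n" "b \<in> braid_words n" by auto
  have "local_move [(i - 1, Cross s), (n - 2 + top_ends (Cross s), Cup d)]
      [(n - 2 + bottom_ends (Cross s), Cup d), (i - 1, Cross s)]"
    by (rule local_move.exchange) (use i in simp)
  moreover have "Suc (Suc (n - 2)) = n" using i by simp
  ultimately have "deforms [(n, Cup d), (i - 1, Cross s)] [(i - 1, Cross s), (n, Cup d)]"
    by (auto intro: deforms_move_reverse)
  from deforms_prepend[OF this, of "crossings b"]
  have "deforms ((n, Cup d) # crossings (l # b)) ((i - 1, Cross s) # (n, Cup d) # crossings b)"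
    by (simp add: l)
  also have "deforms \<dots> (crossings (l # b) @ [(n, Cup d)])"
    using deforms_Cons[OF Cons.IH[OF i(3)]] by (simp add: l)
  finally show ?case .
qed simp

text \<open>The last strand is unhooked as follows. The crossing slides to the other leg of the cap above
  it, the cup rises through \<open>b\<close> until it meets the crossing and untwists it, and what remains is a
  strand that zigzags.\<close>
lemma deforms_destabilise:
  assumes "n \<ge> 1" "b \<in> braid_words n"
  shows "deforms (closure_diagram (Suc n) (b @ [(n, s)])) (closure_diagram n b)"
proof -
  have n: "Suc (n - 1) = n" using assms(1) by simp
  have "closure_diagram (Suc n) (b @ [(n, s)]) =
      (cups n @ (n, Cup Up) # crossings b) @ [(n - 1, Cross s), (n, Cap)] @ caps n"
    by (simp add: closure_diagram_eq cups_Suc caps_Suc)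
  also have "deforms \<dots> ((cups n @ (n, Cup Up) # crossings b) @ [(n, Cross (\<not> s)), (n - 1, Cap)] @ caps n)"
    using deforms_move[OF local_move.slide_cap[of "n - 1" s]] unfolding n by (rule deforms_context)
  also have "\<dots> = cups n @ ((n, Cup Up) # crossings b) @ ([(n, Cross (\<not> s)), (n - 1, Cap)] @ caps n)"
    by simp
  also have "deforms \<dots> (cups n @ (crossings b @ [(n, Cup Up)]) @ ([(n, Cross (\<not> s)), (n - 1, Cap)] @ caps n))"
    by (rule deforms_context[OF deforms_cup_past_crossings[OF assms(2)]])
  also have "\<dots> = (cups n @ crossings b) @ [(n, Cup Up), (n, Cross (\<not> s))] @ ((n - 1, Cap) # caps n)"
    by simp
  also have "deforms \<dots> ((cups n @ crossings b) @ [(n, Cup Down)] @ ((n - 1, Cap) # caps n))"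
    using deforms_move[OF local_move.reidemeister1_cup[of n Up "\<not> s"]]
    by (intro deforms_context) simp
  also have "\<dots> = (cups n @ crossings b) @ [(n, Cup Down), (n - 1, Cap)] @ caps n"
    by simp
  also have "deforms \<dots> ((cups n @ crossings b) @ [] @ caps n)"
    using deforms_move[OF local_move.straighten_right[of "n - 1" Down]] unfolding n
    by (rule deforms_context)
  also have "\<dots> = closure_diagram n b"
    by (simp add: closure_diagram_eq)
  finally show ?thesis .
qed

lemma deforms_crossing_past_crossings:
  assumes "b \<in> braid_words n" "n \<le> j"
  shows "deforms ((j, Cross s) # crossings b) (crossings b @ [(j, Cross s)])"
  using assms(1)
proof (induction b)
  case (Cons l b)
  obtain i t where l: "l = (i, t)" by (cases l)
  with Cons.prems have i: "1 \<le> i" "i < n" "b \<in> braid_words n" by auto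
  have "deforms [(j, Cross s), (i - 1, Cross t)] [(i - 1, Cross t), (j, Cross s)]"
    by (rule deforms_swap_crossings) (use i assms(2) in simp)
  from deforms_prepend[OF this, of "crossings b"]
  have "deforms ((j, Cross s) # crossings (l # b)) ((i - 1, Cross t) # (j, Cross s) # crossings b)"
    by (simp add: l)
  also have "deforms \<dots> (crossings (l # b) @ [(j, Cross s)])"
    using deforms_Cons[OF Cons.IH[OF i(3)]] by (simp add: l)
  finally show ?case .
qed simp

text \<open>The arcs below the braid are nested, so the strands with offsets \<open>i - 1\<close> and \<open>i\<close> continue to the
  right of the braid as those with offsets \<open>2 n - i\<close> and \<open>2 n - 1 - i\<close>. The crossing slides along
  both arcs; it is negated twice, once on each arc.\<close>
lemma deforms_crossing_round_cups:
  assumes "1 \<le> i" "Suc i \<le> n"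
  shows "deforms (cups n @ [(i - 1, Cross s)]) (cups n @ [(2 * n - 1 - i, Cross s)])"
  using assms(2)
proof (induction n rule: dec_induct)
  case base
  obtain k where k: "i = Suc k" using assms(1) by (cases i) auto
  have "deforms [(Suc k, Cup Up), (k, Cross s)] [(k, Cup Up), (Suc k, Cross (\<not> s))]"
    by (rule deforms_move[OF local_move.slide_cup])
  from deforms_Cons[OF this]
  have "deforms [(k, Cup Up), (Suc k, Cup Up), (k, Cross s)]
      [(k, Cup Up), (k, Cup Up), (Suc k, Cross (\<not> s))]" .
  also have "deforms \<dots> [(k, Cup Up), (Suc (Suc k), Cup Up), (Suc k, Cross (\<not> s))]"
    using deforms_prepend[OF deforms_move_reverse[OF local_move.exchange[of k k "Cup Up" "Cup Up"]],
        of "[(Suc k, Cross (\<not> s))]"]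
    by simp
  also have "deforms \<dots> [(k, Cup Up), (Suc k, Cup Up), (Suc (Suc k), Cross s)]"
    using deforms_Cons[OF deforms_move[OF local_move.slide_cup[of "Suc k" Up "\<not> s"]]] by simp
  finally have "deforms [(k, Cup Up), (Suc k, Cup Up), (k, Cross s)]
      [(k, Cup Up), (Suc k, Cup Up), (Suc (Suc k), Cross s)]" .
  from deforms_append[OF this, of "cups k"] show ?case
    by (simp add: k cups_Suc)
next
  case (step n)
  let ?j = "2 * n - 1 - i"
  have "local_move [(i - 1, Cross s), (n - 2 + top_ends (Cross s), Cup Up)]
      [(n - 2 + bottom_ends (Cross s), Cup Up), (i - 1, Cross s)]"
    by (rule local_move.exchange) (use step in simp)
  moreover have "Suc (Suc (n - 2)) = n" using step assms(1) by simp
  ultimately have "deforms [(n, Cup Up), (i - 1, Cross s)] [(i - 1, Cross s), (n, Cup Up)]"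
    by (auto intro: deforms_move_reverse)
  from deforms_append[OF this, of "cups n"]
  have "deforms (cups (Suc n) @ [(i - 1, Cross s)]) ((cups n @ [(i - 1, Cross s)]) @ [(n, Cup Up)])"
    by (simp add: cups_Suc)
  also have "deforms \<dots> ((cups n @ [(?j, Cross s)]) @ [(n, Cup Up)])"
    by (rule deforms_prepend[OF step.IH])
  also have "\<dots> = cups n @ [(?j + bottom_ends (Cup Up), Cross s), (n, Cup Up)]"
    by simp
  also have "deforms \<dots> (cups n @ [(n, Cup Up), (?j + top_ends (Cup Up), Cross s)])"
    by (intro deforms_append deforms_move_reverse local_move.exchange) (use step in auto)
  also have "?j + top_ends (Cup Up) = 2 * Suc n - 1 - i"
    using step by simp
  finally show ?case
    by (simp add: cups_Suc)
qed

lemma deforms_crossing_round_caps: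
  assumes "1 \<le> i" "Suc i \<le> n"
  shows "deforms ((2 * n - 1 - i, Cross s) # caps n) ((i - 1, Cross s) # caps n)"
  using assms(2)
proof (induction n rule: dec_induct)
  case base
  obtain k where k: "i = Suc k" using assms(1) by (cases i) auto
  have "deforms [(Suc (Suc k), Cross s), (Suc k, Cap)] [(Suc k, Cross (\<not> s)), (Suc (Suc k), Cap)]"
    using deforms_move_reverse[OF local_move.slide_cap[of "Suc k" "\<not> s"]] by simp
  from deforms_prepend[OF this, of "[(k, Cap)]"]
  have "deforms [(Suc (Suc k), Cross s), (Suc k, Cap), (k, Cap)]
      [(Suc k, Cross (\<not> s)), (Suc (Suc k), Cap), (k, Cap)]" by simp
  also have "deforms \<dots> [(Suc k, Cross (\<not> s)), (k, Cap), (k, Cap)]"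
    using deforms_Cons[OF deforms_move_reverse[OF local_move.exchange[of k k Cap Cap]]]
    by simp
  also have "deforms \<dots> [(k, Cross s), (Suc k, Cap), (k, Cap)]"
    using deforms_prepend[OF deforms_move_reverse[OF local_move.slide_cap[of k s]], of "[(k, Cap)]"]
    by simp
  finally have "deforms [(Suc (Suc k), Cross s), (Suc k, Cap), (k, Cap)]
      [(k, Cross s), (Suc k, Cap), (k, Cap)]" .
  from deforms_prepend[OF this, of "caps k"] show ?case
    by (simp add: k caps_Suc)
next
  case (step n)
  let ?j = "2 * n - 1 - i"
  have "(2 * Suc n - 1 - i, Cross s) # caps (Suc n) =
      [(?j + bottom_ends Cap, Cross s), (n, Cap)] @ caps n"
    using step by (simp add: caps_Suc)
  also have "deforms \<dots> ([(n, Cap), (?j + top_ends Cap, Cross s)] @ caps n)"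
    by (intro deforms_prepend deforms_move_reverse local_move.exchange) (use step in auto)
  also have "deforms \<dots> ((n, Cap) # (i - 1, Cross s) # caps n)"
    using deforms_Cons[OF step.IH] by simp
  also have "\<dots> = [(n - 2 + bottom_ends (Cross s), Cap), (i - 1, Cross s)] @ caps n"
    using step assms(1) by simp
  also have "deforms \<dots> ([(i - 1, Cross s), (n - 2 + top_ends (Cross s), Cap)] @ caps n)"
    by (intro deforms_prepend deforms_move_reverse local_move.exchange) (use step in auto)
  also have "\<dots> = (i - 1, Cross s) # caps (Suc n)"
    using step assms(1) by (simp add: caps_Suc)
  finally show ?case .
qed

text \<open>A crossing at the bottom of the braid travels along the closing arcs: round the cups, up on the
  right-hand side, and round the caps back to the top of the braid.\<close>
lemma deforms_conjugate:
  assumes "1 \<le> i" "i < n" "b \<in> braid_words n"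
  shows "deforms (closure_diagram n ((i, s) # b)) (closure_diagram n (b @ [(i, s)]))"
proof -
  let ?j = "2 * n - 1 - i"
  have "closure_diagram n ((i, s) # b) = (cups n @ [(i - 1, Cross s)]) @ (crossings b @ caps n)"
    by (simp add: closure_diagram_eq)
  also have "deforms \<dots> ((cups n @ [(?j, Cross s)]) @ (crossings b @ caps n))"
    using assms by (intro deforms_prepend deforms_crossing_round_cups) auto
  also have "\<dots> = cups n @ ((?j, Cross s) # crossings b) @ caps n"
    by simp
  also have "deforms \<dots> (cups n @ (crossings b @ [(?j, Cross s)]) @ caps n)"
    using assms by (intro deforms_context deforms_crossing_past_crossings) auto
  also have "\<dots> = (cups n @ crossings b) @ ((?j, Cross s) # caps n)"
    by simp
  also have "deforms \<dots> ((cups n @ crossings b) @ ((i - 1, Cross s) # caps n))"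
    using assms by (intro deforms_append deforms_crossing_round_caps) auto
  also have "\<dots> = closure_diagram n (b @ [(i, s)])"
    by (simp add: closure_diagram_eq)
  finally show ?thesis .
qed

text \<open>The directions of the strands on the level of the braid, which ascend in the braid and descend
  in the closing arcs.\<close>
definition closure_ends :: "nat \<Rightarrow> dir list" where
  "closure_ends n = replicate n Up @ replicate n Down"

lemma closure_ends_Suc:
  "closure_ends (Suc n) = replicate n Up @ [Up, opp Up] @ replicate n Down"
  by (simp add: closure_ends_def replicate_app_Cons_same)

lemma closure_ends_split:
  assumes "1 \<le> i" "i < n"
  obtains ys where "closure_ends n = replicate (i - 1) Up @ [Up, Up] @ ys"
proof -
  have "n = (i - 1) + Suc (Suc (n - Suc i))" using assms by simp
  then have "closure_ends n = replicate (i - 1) Up @ [Up, Up] @ replicate (n - Suc i) Up @ replicate n Down"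
    unfolding closure_ends_def by (metis append.assoc append_Cons append_Nil replicate_Suc replicate_add)
  then show ?thesis by (rule that)
qed

lemma tangle_cups: "tangle [] (cups n) (closure_ends n)"
proof (induction n)
  case (Suc n)
  have "attaches (closure_ends n) (n, Cup Up) (closure_ends (Suc n))"
    using attaches.cup[of "replicate n Up" "replicate n Down" Up]
    unfolding closure_ends_Suc by (simp add: closure_ends_def)
  with Suc show ?case
    by (auto simp: cups_Suc tangle_append_iff tangle_Cons_iff)
qed (simp add: cups_def closure_ends_def)

lemma tangle_caps: "tangle (closure_ends n) (caps n) []"
proof (induction n)
  case (Suc n)
  have "attaches (closure_ends (Suc n)) (n, Cap) (closure_ends n)"
    using attaches.cap[of "replicate n Up" Up "replicate n Down"]
    unfolding closure_ends_Suc by (simp add: closure_ends_def)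
  with Suc show ?case
    by (auto simp: caps_Suc tangle_Cons_iff)
qed (simp add: caps_def closure_ends_def)

lemma tangle_crossings:
  "b \<in> braid_words n \<Longrightarrow> tangle (closure_ends n) (crossings b) (closure_ends n)"
proof (induction b)
  case (Cons l b)
  obtain i s where l: "l = (i, s)" by (cases l)
  with Cons.prems have i: "1 \<le> i" "i < n" "b \<in> braid_words n" by auto
  from closure_ends_split[OF i(1,2)] obtain ys
    where ys: "closure_ends n = replicate (i - 1) Up @ [Up, Up] @ ys" .
  have "attaches (closure_ends n) (i - 1, Cross s) (closure_ends n)"
    using attaches.cross[of "replicate (i - 1) Up" Up Up ys s] unfolding ys by simp
  with Cons.IH[OF i(3)] show ?case by (auto simp: l tangle_Cons_iff)
qed simp

lemma link_diagram_closure: "b \<in> braid_words n \<Longrightarrow> link_diagram (closure_diagram n b)"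
  unfolding link_diagram_def closure_diagram_eq tangle_append_iff
  using tangle_cups tangle_caps tangle_crossings by blast

lemma isotopic_closure_deforms:
  "deforms (closure_diagram n b) (closure_diagram m c) \<Longrightarrow> b \<in> braid_words n \<Longrightarrow>
    isotopic (closure_diagram n b) (closure_diagram m c)"
  using link_diagram_closure unfolding deforms_def by (metis append_Nil append_Nil2)

lemma braid_relation_move:
  assumes "braid_relation a b" "a \<in> braid_words n"
  shows "local_move (crossings a) (crossings b)"
  using assms(1)
proof cases
  case (inverse i s)
  then show ?thesis by (simp add: local_move.reidemeister2)
next
  case (commute i j)
  with assms(2) have ij: "1 \<le> i" "i + 2 \<le> j" by auto
  have "local_move [(i - 1, Cross True), (j - 3 + top_ends (Cross True), Cross True)]
      [(j - 3 + bottom_ends (Cross True), Cross True), (i - 1, Cross True)]"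
    by (rule local_move.exchange) (use ij in simp)
  moreover have "j - 3 + 2 = j - 1" using ij by simp
  ultimately show ?thesis using commute by simp
next
  case (braid i)
  with assms(2) have i: "Suc (i - 1) = i" by simp
  show ?thesis
    using local_move.reidemeister3[of True True True "i - 1"] braid i by simp
qed

lemma isotopic_closure_braid_equiv:
  assumes "braid_equiv n b c"
  shows "isotopic (closure_diagram n b) (closure_diagram n c)"
  using assms unfolding braid_equiv_def
proof (induction rule: equivclp_induct)
  case base
  show ?case by (simp add: isotopic_def)
next
  case (step y z)
  have *: "isotopic (closure_diagram n y) (closure_diagram n z)" if "braid_step n y z" for y z
    using that
  proof cases
    case (1 a b c d)
    then have "a \<in> braid_words n" by simp
    then have "local_move (crossings a) (crossings b)"
      using 1 braid_relation_move by blast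
    moreover have "link_diagram (closure_diagram n y)" "link_diagram (closure_diagram n z)"
      using 1 link_diagram_closure by auto
    ultimately show ?thesis
      using isotopic_move[of "crossings a" "crossings b" "cups n @ crossings c" "crossings d @ caps n"] 1
      by (simp add: closure_diagram_eq)
  qed
  with step show ?case by (metis isotopic_sym isotopic_trans)
qed

section \<open>The Homflypt polynomial of a closed braid\<close>

definition closure_value :: "(diagram \<Rightarrow> laurent) \<Rightarrow> nat \<Rightarrow> braid_word \<Rightarrow> laurent" where
  "closure_value P n b = P (closure_diagram n b)"

lemma v_power_mult: "v_power k * v_power l = v_power (k + l)"
  by (simp add: v_power_def mult_single)

lemma v_power_0 [simp]: "v_power 0 = 1"
  by (simp add: v_power_def)

lemma const_z_inverse: "const_v (z_power (-1)) * const_v (z_power 1) = 1"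
  by (simp add: const_v_def z_power_def mult_single)

lemma closure_value_unknot: "homflypt P \<Longrightarrow> closure_value P 1 [] = 1"
  by (simp add: homflypt_def closure_value_def closure_diagram_def unknot_def)

lemma closure_value_braid_equiv:
  "homflypt P \<Longrightarrow> braid_equiv n b c \<Longrightarrow> closure_value P n b = closure_value P n c"
  unfolding closure_value_def homflypt_def using isotopic_closure_braid_equiv by blast

lemma closure_value_conjugate:
  assumes "homflypt P" "a \<in> braid_words n" "b \<in> braid_words n"
  shows "closure_value P n (a @ b) = closure_value P n (b @ a)"
  using assms(2,3)
proof (induction a arbitrary: b)
  case (Cons l a)
  obtain i s where l: "l = (i, s)" by (cases l)
  have "deforms (closure_diagram n ((i, s) # (a @ b))) (closure_diagram n ((a @ b) @ [(i, s)]))"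
    by (rule deforms_conjugate) (use Cons.prems l in auto)
  then have "isotopic (closure_diagram n ((i, s) # (a @ b))) (closure_diagram n ((a @ b) @ [(i, s)]))"
    by (rule isotopic_closure_deforms) (use Cons.prems l in auto)
  then have "closure_value P n (l # a @ b) = closure_value P n (a @ (b @ [l]))"
    using assms(1) by (simp add: l closure_value_def homflypt_def)
  also have "\<dots> = closure_value P n ((b @ [l]) @ a)"
    using Cons l by (intro Cons.IH) auto
  finally show ?case by simp
qed simp

lemma closure_value_destabilise:
  assumes "homflypt P" "n \<ge> 1" "b \<in> braid_words n"
  shows "closure_value P (Suc n) (b @ [(n, s)]) = closure_value P n b"
proof -
  have "b @ [(n, s)] \<in> braid_words (Suc n)"
    using assms(2,3) by (auto simp: braid_words_def)
  from isotopic_closure_deforms[OF deforms_destabilise[OF assms(2,3)] this]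
  show ?thesis using assms(1) by (simp add: closure_value_def homflypt_def)
qed

lemma closure_value_skein:
  assumes "homflypt P" "1 \<le> i" "i < n" "a \<in> braid_words n" "b \<in> braid_words n"
  shows "v_power (-1) * closure_value P n (a @ [(i, True)] @ b)
      - v_power 1 * closure_value P n (a @ [(i, False)] @ b)
    = const_v (z_power 1) * closure_value P n (a @ b)"
proof -
  from closure_ends_split[OF assms(2,3)] obtain ys
    where ys: "closure_ends n = replicate (i - 1) Up @ [Up, Up] @ ys" .
  have "tangle [] (cups n @ crossings a) (replicate (i - 1) Up @ [Up, Up] @ ys)"
    using tangle_cups tangle_crossings[OF assms(4)] unfolding ys[symmetric] tangle_append_iff by blast
  moreover have "tangle (replicate (i - 1) Up @ [Up, Up] @ ys) (crossings b @ caps n) []"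
    using tangle_caps tangle_crossings[OF assms(5)] unfolding ys[symmetric] tangle_append_iff by blast
  ultimately have "skein_triple
      ((cups n @ crossings a) @ [(i - 1, Cross (Up = Up))] @ (crossings b @ caps n))
      ((cups n @ crossings a) @ [(i - 1, Cross (Up \<noteq> Up))] @ (crossings b @ caps n))
      ((cups n @ crossings a) @ smoothing (i - 1) Up Up @ (crossings b @ caps n))"
    by (rule skein_triple.intros) simp
  then have "skein_triple (closure_diagram n (a @ [(i, True)] @ b))
      (closure_diagram n (a @ [(i, False)] @ b)) (closure_diagram n (a @ b))"
    by (simp add: closure_diagram_eq smoothing_def)
  then show ?thesis
    using assms(1) unfolding homflypt_def closure_value_def by blast
qed

text \<open>The effect on the Homflypt polynomial of adding a disjoint unknotted circle.\<close>
definition circle_factor :: laurent where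
  "circle_factor = (v_power (-1) - v_power 1) * const_v (z_power (-1))"

lemma circle_factor_eq:
  "circle_factor = Poly_Mapping.single (-1) (z_power (-1)) + Poly_Mapping.single 1 (- z_power (-1))"
  by (simp add: circle_factor_def v_power_def const_v_def left_diff_distrib mult_single single_uminus)

text \<open>The skein relation at a crossing of the added strand with its neighbour: both signs of the crossing
  give stabilisations of \<open>b\<close>.\<close>
lemma closure_value_add_strand:
  assumes "homflypt P" "n \<ge> 1" "b \<in> braid_words n"
  shows "closure_value P (Suc n) b =
    circle_factor * closure_value P n b"
proof -
  have "b \<in> braid_words (Suc n)" using assms(3) by (auto simp: braid_words_def)
  then have "(v_power (-1) - v_power 1) * closure_value P n b
      = const_v (z_power 1) * closure_value P (Suc n) b"
    using closure_value_skein[of P n "Suc n" b "[]"] closure_value_destabilise assms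
    by (simp add: left_diff_distrib)
  then have "const_v (z_power (-1)) * ((v_power (-1) - v_power 1) * closure_value P n b)
      = (const_v (z_power (-1)) * const_v (z_power 1)) * closure_value P (Suc n) b"
    by (simp only: mult.assoc)
  then have "closure_value P (Suc n) b =
      const_v (z_power (-1)) * ((v_power (-1) - v_power 1) * closure_value P n b)"
    unfolding const_z_inverse by simp
  then show ?thesis by (simp only: circle_factor_def mult_ac)
qed

lemma braid_equiv_relation:
  "braid_relation a b \<Longrightarrow> c @ a @ d \<in> braid_words n \<Longrightarrow> c @ b @ d \<in> braid_words n \<Longrightarrow>
    braid_equiv n (c @ a @ d) (c @ b @ d)"
  unfolding braid_equiv_def by (blast intro: braid_step.intros)

text \<open>The quadratic relation \<open>\<sigma>\<^sub>i\<^sup>2 = v\<^sup>2 + v z \<sigma>\<^sub>i\<close>, from the skein relation at the first of the two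
  crossings: changing it cancels both, smoothing it leaves one.\<close>
lemma closure_value_square:
  assumes "homflypt P" "1 \<le> i" "i < n" "a \<in> braid_words n" "b \<in> braid_words n"
  shows "closure_value P n (a @ [(i, True), (i, True)] @ b) =
    v_power 2 * closure_value P n (a @ b)
    + v_power 1 * const_v (z_power 1) * closure_value P n (a @ [(i, True)] @ b)"
proof -
  have "braid_equiv n (a @ [(i, False), (i, True)] @ b) (a @ [] @ b)"
    using braid_relation.inverse[of i False] by (intro braid_equiv_relation) (use assms in auto)
  then have "closure_value P n (a @ [(i, False), (i, True)] @ b) = closure_value P n (a @ b)"
    using closure_value_braid_equiv[OF assms(1)] by fastforce
  with closure_value_skein[of P i n a "(i, True) # b"] assms
  have *: "v_power (-1) * closure_value P n (a @ [(i, True), (i, True)] @ b) =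
      v_power 1 * closure_value P n (a @ b)
      + const_v (z_power 1) * closure_value P n (a @ [(i, True)] @ b)"
    by (simp add: algebra_simps)
  have "closure_value P n (a @ [(i, True), (i, True)] @ b) =
      v_power 1 * (v_power (-1) * closure_value P n (a @ [(i, True), (i, True)] @ b))"
    by (simp add: mult.assoc[symmetric] v_power_mult)
  also have "\<dots> = (v_power 1 * v_power 1) * closure_value P n (a @ b)
      + v_power 1 * const_v (z_power 1) * closure_value P n (a @ [(i, True)] @ b)"
    unfolding * by (simp only: distrib_left mult.assoc)
  finally show ?thesis by (simp add: v_power_mult)
qed

section \<open>Degrees in v\<close>

definition v_degree_le :: "laurent \<Rightarrow> int \<Rightarrow> bool" where
  "v_degree_le p d \<longleftrightarrow> (\<forall>k \<in> Poly_Mapping.keys p. k \<le> d)"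

lemma v_degree_le_mono: "v_degree_le p c \<Longrightarrow> c \<le> d \<Longrightarrow> v_degree_le p d"
  by (auto simp: v_degree_le_def)

lemma v_degree_le_add: "v_degree_le p d \<Longrightarrow> v_degree_le q d \<Longrightarrow> v_degree_le (p + q) d"
  using keys_add[of p q] by (auto simp: v_degree_le_def)

lemma v_degree_le_mult: "v_degree_le p c \<Longrightarrow> v_degree_le q d \<Longrightarrow> v_degree_le (p * q) (c + d)"
  using keys_mult[of p q] by (fastforce simp: v_degree_le_def)

lemma v_degree_le_single: "v_degree_le (Poly_Mapping.single k c) k"
  by (simp add: v_degree_le_def)

lemma v_degree_le_v_power: "v_degree_le (v_power k) k"
  unfolding v_power_def by (rule v_degree_le_single)

lemma v_degree_le_const_v: "v_degree_le (const_v c) 0"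
  unfolding const_v_def by (rule v_degree_le_single)

lemma v_degree_le_circle_factor:
  "v_degree_le (circle_factor) 1"
  unfolding circle_factor_eq
  by (intro v_degree_le_add v_degree_le_mono[OF v_degree_le_single]) auto

lemma lookup_single_mult:
  fixes p :: laurent
  shows "Poly_Mapping.lookup (Poly_Mapping.single k c * p) j = c * Poly_Mapping.lookup p (j - k)"
proof -
  have eq: "j = k + q \<longleftrightarrow> j - k = q" for q by auto
  show ?thesis
    by (simp add: lookup_mult lookup_single when_mult eq Sum_any_when_equal Sum_any_when_equal')
qed

lemma v_coeff_circle_factor_mult:
  assumes "v_degree_le p d"
  shows "v_coeff (circle_factor * p) (d + 1)
    = - z_power (-1) * v_coeff p d"
proof -
  \<comment> \<open>The term \<open>v\<inverse> z\<inverse>\<close> of the factor would need degree \<open>d + 2\<close> in \<open>p\<close> to contribute.\<close>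
  have "d + 1 - (-1) \<notin> Poly_Mapping.keys p" using assms by (auto simp: v_degree_le_def)
  then have "Poly_Mapping.lookup p (d + 1 - (-1)) = 0" by (simp only: in_keys_iff not_not)
  then show ?thesis
    unfolding circle_factor_eq v_coeff_def distrib_right lookup_add lookup_single_mult by simp
qed

lemma closure_value_identity:
  assumes "homflypt P"
  shows "v_degree_le (closure_value P (Suc m) []) (int m)
    \<and> v_coeff (closure_value P (Suc m) []) (int m) = (- z_power (-1)) ^ m"
proof (induction m)
  case 0
  then show ?case
    using closure_value_unknot[OF assms] by (simp add: v_degree_le_def v_coeff_def lookup_one)
next
  case (Suc m)
  have eq: "closure_value P (Suc (Suc m)) [] =
      circle_factor * closure_value P (Suc m) []"
    by (rule closure_value_add_strand[OF assms]) auto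
  have "v_degree_le (closure_value P (Suc (Suc m)) []) (1 + int m)"
    unfolding eq by (rule v_degree_le_mult[OF v_degree_le_circle_factor]) (use Suc in simp)
  moreover have "v_coeff (closure_value P (Suc (Suc m)) []) (int m + 1) = (- z_power (-1)) ^ Suc m"
    unfolding eq using v_coeff_circle_factor_mult Suc by simp
  ultimately show ?case by (simp add: add.commute)
qed

lemma max_v_degree_eqI:
  "v_degree_le p d \<Longrightarrow> v_coeff p d \<noteq> 0 \<Longrightarrow> max_v_degree p = Fin d"
  by (auto simp: max_v_degree_def v_coeff_def v_degree_le_def in_keys_iff intro!: Max_eqI)

lemma max_v_degree_le: "max_v_degree p = Fin d \<Longrightarrow> v_degree_le p c \<Longrightarrow> d \<le> c"
  by (auto simp: max_v_degree_def v_degree_le_def split: if_splits)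

lemma strand_coefficient_nonzero: "(- z_power (-1)) ^ m \<noteq> 0"
proof -
  have "(- z_power (-1)) * (- z_power 1) = (1 :: zlaurent)"
    by (simp add: z_power_def mult_single)
  then have "(- z_power (-1)) ^ m * (- z_power 1) ^ m = (1 :: zlaurent)"
    by (metis power_mult_distrib power_one)
  then show ?thesis by (metis mult_zero_left zero_neq_one)
qed

section \<open>Positive words and squares\<close>

definition positive_word :: "nat list \<Rightarrow> braid_word" where
  "positive_word js = map (\<lambda>i. (i, True)) js"

lemma positive_word_simps [simp]:
  "positive_word [] = []"
  "positive_word (i # js) = (i, True) # positive_word js"
  "positive_word (js @ ks) = positive_word js @ positive_word ks"
  by (simp_all add: positive_word_def)

lemma positive_word_in_braid_words [simp]:
  "positive_word js \<in> braid_words n \<longleftrightarrow> set js \<subseteq> {1..<n}"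
  by (auto simp: positive_word_def braid_words_def)

text \<open>Equality in the monoid of positive braids. Its relations do not change the set of letters, so
  the number of strands need not be mentioned, and a word on fewer strands has
  the same equivalents on more strands.\<close>
inductive positive_equiv :: "nat list \<Rightarrow> nat list \<Rightarrow> bool" where
  commute: "i + 2 \<le> j \<Longrightarrow> positive_equiv [i, j] [j, i]"
| braid: "positive_equiv [i, Suc i, i] [Suc i, i, Suc i]"
| refl: "positive_equiv u u"
| sym: "positive_equiv u v \<Longrightarrow> positive_equiv v u"
| trans [trans]: "positive_equiv u v \<Longrightarrow> positive_equiv v w \<Longrightarrow> positive_equiv u w"
| embed: "positive_equiv u v \<Longrightarrow> positive_equiv (x @ u @ y) (x @ v @ y)"

lemma positive_equiv_length: "positive_equiv u v \<Longrightarrow> length u = length v"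
  by (induction rule: positive_equiv.induct) auto

lemma positive_equiv_set: "positive_equiv u v \<Longrightarrow> set u = set v"
  by (induction rule: positive_equiv.induct) auto

lemma transposition_product_simps [simp]:
  "transposition_product [] = id"
  "transposition_product (i # js) = transpose i (Suc i) \<circ> transposition_product js"
  by (simp_all add: transposition_product_def)

lemma transposition_product_append [simp]:
  "transposition_product (js @ ks) = transposition_product js \<circ> transposition_product ks"
  by (induction js) (auto simp: comp_assoc)

lemma positive_equiv_transposition_product:
  "positive_equiv u v \<Longrightarrow> transposition_product u = transposition_product v"
proof (induction rule: positive_equiv.induct)
  case (commute i j)
  then show ?case by (auto simp: fun_eq_iff transpose_def)
next
  case (braid i)
  then show ?case by (auto simp: fun_eq_iff transpose_def)
qed auto

lemma positive_equiv_braid_equiv: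
  assumes "positive_equiv u v" "set (x @ u @ y) \<subseteq> {1..<n}"
  shows "braid_equiv n (positive_word (x @ u @ y)) (positive_word (x @ v @ y))"
  using assms
proof (induction arbitrary: x y rule: positive_equiv.induct)
  case (commute i j)
  then show ?case
    using braid_equiv_relation[OF braid_relation.commute, of i j "positive_word x" "positive_word y" n]
    by simp
next
  case (braid i)
  then show ?case
    using braid_equiv_relation[OF braid_relation.braid, of "positive_word x" i "positive_word y" n]
    by simp
next
  case (refl u)
  then show ?case by (simp add: braid_equiv_def)
next
  case (sym u v)
  have "set (x @ u @ y) \<subseteq> {1..<n}" using sym positive_equiv_set by simp
  then show ?case using sym.IH unfolding braid_equiv_def by (blast intro: equivclp_sym)
next
  case (trans u v w)
  have "set (x @ v @ y) \<subseteq> {1..<n}" using trans positive_equiv_set by simp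
  then show ?case using trans unfolding braid_equiv_def by (blast intro: equivclp_trans)
next
  case (embed u v x' y')
  then show ?case using embed.IH[of "x @ x'" "y' @ y"] by simp
qed

lemma closure_value_positive_equiv:
  assumes "homflypt P" "positive_equiv u v" "set u \<subseteq> {1..<n}"
  shows "closure_value P n (positive_word u) = closure_value P n (positive_word v)"
  using closure_value_braid_equiv[OF assms(1)] positive_equiv_braid_equiv[OF assms(2), of "[]" "[]" n]
    assms(3) by simp

definition has_square :: "nat list \<Rightarrow> bool" where
  "has_square u \<longleftrightarrow> (\<exists>a i b. positive_equiv u (a @ [i, i] @ b))"

lemma has_square_equiv: "positive_equiv u v \<Longrightarrow> has_square v \<Longrightarrow> has_square u"
  unfolding has_square_def by (blast intro: positive_equiv.trans)

lemma has_square_context: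
  assumes "has_square u"
  shows "has_square (x @ u @ y)"
proof -
  from assms obtain a i b where "positive_equiv u (a @ [i, i] @ b)"
    unfolding has_square_def by blast
  from positive_equiv.embed[OF this, of x y]
  have "positive_equiv (x @ u @ y) ((x @ a) @ [i, i] @ (b @ y))" by simp
  then show ?thesis unfolding has_square_def by blast
qed

lemma positive_equiv_commute_word:
  assumes "\<forall>i \<in> set u. i + 2 \<le> j"
  shows "positive_equiv (j # u) (u @ [j])"
  using assms
proof (induction u)
  case (Cons i u)
  have "positive_equiv [j, i] [i, j]"
    using Cons.prems by (auto intro: positive_equiv.sym[OF positive_equiv.commute])
  from positive_equiv.embed[OF this, of "[]" u]
  have "positive_equiv (j # i # u) (i # j # u)" by simp
  also have "positive_equiv \<dots> (i # u @ [j])"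
    using positive_equiv.embed[OF Cons.IH, of "[i]" "[]"] Cons.prems by simp
  finally show ?case by simp
qed (simp add: positive_equiv.refl)

text \<open>Two consecutive occurrences of the top letter enclose a word \<open>q\<close> in smaller letters, to which the
  induction on the alphabet applies. If \<open>q\<close> has no square, the second letter from the top occurs in
  it at most once. If it does not occur, the two top letters commute past \<open>q\<close> and form a square; if
  it occurs once, they commute up to it and the braid relation replaces two top
  letters by one.\<close>
lemma square_or_few_top_letters:
  assumes "set u \<subseteq> {1..m}"
  shows "has_square u \<or> (\<exists>v. positive_equiv u v \<and> count_list v m \<le> 1)"
  using assms
proof (induction m arbitrary: u)
  case 0
  then show ?case using positive_equiv.refl by (intro disjI2 exI[of _ "[]"]) auto
next
  case (Suc m)
  show ?case
    using Suc.prems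
  proof (induction "count_list u (Suc m)" arbitrary: u rule: less_induct)
    case less
    show ?case
    proof (cases "count_list u (Suc m) \<le> 1")
      case True
      then show ?thesis using positive_equiv.refl by blast
    next
      case False
      then have "Suc m \<in> set u" by (metis count_notin zero_le)
      then obtain p u' where u': "u = p @ Suc m # u'" "Suc m \<notin> set p"
        using split_list_first by metis
      with False have "Suc m \<in> set u'" by (metis add.right_neutral add_0 count_list.simps(2) count_list_append count_notin
         One_nat_def order_refl)
      then obtain q r where q: "u' = q @ Suc m # r" "Suc m \<notin> set q"
        using split_list_first by metis
      have u: "u = p @ (Suc m # q @ [Suc m]) @ r" using u' q by simp
      have q_set: "set q \<subseteq> {1..m}"
      proof
        fix i assume i: "i \<in> set q"
        with less.prems u have "i \<in> {1..Suc m}" by auto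
        with i q(2) show "i \<in> {1..m}" by (cases "i = Suc m") auto
      qed
      from Suc.IH[OF q_set] show ?thesis
      proof
        assume "has_square q"
        from has_square_context[OF this, of "p @ [Suc m]" "Suc m # r"] show ?thesis
          by (simp add: u)
      next
        assume "\<exists>v. positive_equiv q v \<and> count_list v m \<le> 1"
        then obtain v where v: "positive_equiv q v" "count_list v m \<le> 1" by blast
        have v_set: "set v \<subseteq> {1..m}" using q_set positive_equiv_set[OF v(1)] by simp
        have qv: "positive_equiv (Suc m # q @ [Suc m]) (Suc m # v @ [Suc m])"
          using positive_equiv.embed[OF v(1), of "[Suc m]" "[Suc m]"] by simp
        show ?thesis
        proof (cases "m \<in> set v")
          case False
          have "\<forall>i \<in> set v. i + 2 \<le> Suc m"
          proof
            fix i assume "i \<in> set v"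
            with v_set False have "i \<le> m" "i \<noteq> m" by auto
            then show "i + 2 \<le> Suc m" by simp
          qed
          from positive_equiv.embed[OF positive_equiv_commute_word[OF this], of "[]" "[Suc m]"]
          have "positive_equiv (Suc m # v @ [Suc m]) (v @ [Suc m, Suc m] @ [])" by simp
          then have "has_square (Suc m # v @ [Suc m])" unfolding has_square_def by blast
          then show ?thesis
            using has_square_equiv[OF qv] has_square_context u by blast
        next
          case True
          then obtain x y where xy: "v = x @ m # y" "m \<notin> set x"
            using split_list_first by metis
          then have "m \<notin> set y" using v(2) by (auto simp: count_list_0_iff)
          have small: "\<forall>i \<in> set x \<union> set y. i + 2 \<le> Suc m"
          proof
            fix i assume "i \<in> set x \<union> set y"
            with v_set xy \<open>m \<notin> set y\<close> have "i \<le> m" "i \<noteq> m" by auto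
            then show "i + 2 \<le> Suc m" by simp
          qed
          have "positive_equiv (Suc m # v @ [Suc m]) (x @ [Suc m, m] @ y @ [Suc m])"
            using positive_equiv.embed[OF positive_equiv_commute_word[of x "Suc m"],
                of "[]" "m # y @ [Suc m]"] small xy by simp
          also have "positive_equiv \<dots> (x @ [Suc m, m, Suc m] @ y)"
            using positive_equiv.embed[OF positive_equiv.sym[OF positive_equiv_commute_word[of y "Suc m"]],
                of "x @ [Suc m, m]" "[]"] small by simp
          also have "positive_equiv \<dots> (x @ [m, Suc m, m] @ y)"
            by (intro positive_equiv.embed positive_equiv.sym[OF positive_equiv.braid])
          finally have "positive_equiv (Suc m # v @ [Suc m]) (x @ [m, Suc m, m] @ y)" .
          with qv have "positive_equiv (Suc m # q @ [Suc m]) (x @ [m, Suc m, m] @ y)"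
            by (rule positive_equiv.trans)
          from positive_equiv.embed[OF this, of p r]
          have equiv: "positive_equiv u (p @ (x @ [m, Suc m, m] @ y) @ r)" unfolding u .
          have "Suc m \<notin> set x \<union> set y" using small[rule_format, of "Suc m"] by auto
          then have "count_list (p @ (x @ [m, Suc m, m] @ y) @ r) (Suc m) < count_list u (Suc m)"
            using q(2) by (simp add: u)
          moreover have "set (p @ (x @ [m, Suc m, m] @ y) @ r) \<subseteq> {1..Suc m}"
            using less.prems positive_equiv_set[OF equiv] by simp
          ultimately show ?thesis
            using less.hyps has_square_equiv[OF equiv] positive_equiv.trans[OF equiv] by blast
        qed
      qed
    qed
  qed
qed

lemma positive_word_cases:
  assumes "set u \<subseteq> {1..<Suc n}"
  obtains
    (square) a i b where "positive_equiv u (a @ [i, i] @ b)"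
  | (unused) v where "positive_equiv u v" "set v \<subseteq> {1..<n}"
  | (once) x y where "positive_equiv u (x @ n # y)" "set (y @ x) \<subseteq> {1..<n}"
proof -
  have "set u \<subseteq> {1..n}" using assms by auto
  from square_or_few_top_letters[OF this] show ?thesis
  proof
    assume "has_square u"
    then show ?thesis using square unfolding has_square_def by blast
  next
    assume "\<exists>v. positive_equiv u v \<and> count_list v n \<le> 1"
    then obtain v where v: "positive_equiv u v" "count_list v n \<le> 1" by blast
    have v_set: "set v \<subseteq> {1..n}" using \<open>set u \<subseteq> {1..n}\<close> positive_equiv_set[OF v(1)] by simp
    show ?thesis
    proof (cases "n \<in> set v")
      case False
      have "set v \<subseteq> {1..<n}"
      proof
        fix i assume "i \<in> set v"
        with v_set False have "1 \<le> i" "i \<le> n" "i \<noteq> n" by auto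
        then show "i \<in> {1..<n}" by simp
      qed
      with v(1) show ?thesis by (rule unused)
    next
      case True
      then obtain x y where xy: "v = x @ n # y" "n \<notin> set x"
        using split_list_first by metis
      then have "n \<notin> set y" using v(2) by (auto simp: count_list_0_iff)
      have "set (y @ x) \<subseteq> {1..<n}"
      proof
        fix i assume "i \<in> set (y @ x)"
        with v_set xy \<open>n \<notin> set y\<close> have "1 \<le> i" "i \<le> n" "i \<noteq> n" by auto
        then show "i \<in> {1..<n}" by simp
      qed
      with v(1) xy show ?thesis by (intro once) auto
    qed
  qed
qed

text \<open>Conjugation brings the only occurrence of the top letter to the end of the word, where it is
  removed together with the last strand.\<close>
lemma closure_value_once:
  assumes "homflypt P" "n \<ge> 1" "set (y @ x) \<subseteq> {1..<n}"
  shows "closure_value P (Suc n) (positive_word (x @ n # y)) = closure_value P n (positive_word (y @ x))"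
proof -
  have "set (y @ x) \<subseteq> {1..<Suc n}"
    using assms(3) by auto
  then have "closure_value P (Suc n) (positive_word (x @ [n]) @ positive_word y) =
      closure_value P (Suc n) (positive_word y @ positive_word (x @ [n]))"
    by (intro closure_value_conjugate assms(1)) (use assms(2) in auto)
  also have "\<dots> = closure_value P (Suc n) (positive_word (y @ x) @ [(n, True)])"
    by simp
  also have "\<dots> = closure_value P n (positive_word (y @ x))"
    by (intro closure_value_destabilise assms(1,2)) (use assms(3) in simp)
  finally show ?thesis by simp
qed

section \<open>Degree bounds for closures of positive words\<close>

text \<open>Lexicographic induction on the number of strands and the length of the word: a square leads to
  shorter words on the same strands, the other two cases to words on fewer strands.\<close>
lemma v_degree_positive_closure:
  assumes "homflypt P" "n \<ge> 1" "set u \<subseteq> {1..<n}"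
  shows "v_degree_le (closure_value P n (positive_word u)) (int (length u) + int n - 1)"
  using assms(2,3)
proof (induction n arbitrary: u rule: nat_induct_at_least)
  case base
  then have "u = []" by simp
  then show ?case using closure_value_unknot[OF assms(1)] by (simp add: v_degree_le_def)
next
  case (Suc n)
  show ?case using Suc.prems
  proof (induction u rule: length_induct)
    case (1 u)
    note value_equiv = closure_value_positive_equiv[OF assms(1) _ 1(2)]
    from 1(2) show ?case
    proof (cases rule: positive_word_cases)
      case (square a i b)
      have len: "length u = length a + length b + 2"
        using positive_equiv_length[OF square] by simp
      have sets: "1 \<le> i" "i < Suc n" "set a \<subseteq> {1..<Suc n}" "set b \<subseteq> {1..<Suc n}"
        using positive_equiv_set[OF square] 1(2) by auto
      have "v_degree_le (closure_value P (Suc n) (positive_word (a @ b))) (int (length (a @ b)) + int (Suc n) - 1)"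
        by (rule 1(1)[rule_format]) (use len sets in auto)
      from v_degree_le_mult[OF v_degree_le_v_power[of 2] this]
      have ab: "v_degree_le (v_power 2 * closure_value P (Suc n) (positive_word a @ positive_word b))
          (int (length u) + int (Suc n) - 1)"
        by (simp add: len algebra_simps)
      have "v_degree_le (closure_value P (Suc n) (positive_word (a @ [i] @ b)))
          (int (length (a @ [i] @ b)) + int (Suc n) - 1)"
        by (rule 1(1)[rule_format]) (use len sets in auto)
      from v_degree_le_mult[OF v_degree_le_mult[OF v_degree_le_v_power[of 1] v_degree_le_const_v[of "z_power 1"]] this]
      have aib: "v_degree_le (v_power 1 * const_v (z_power 1) *
            closure_value P (Suc n) (positive_word a @ [(i, True)] @ positive_word b))
          (int (length u) + int (Suc n) - 1)"
        by (simp add: len algebra_simps)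
      have "closure_value P (Suc n) (positive_word u) =
          v_power 2 * closure_value P (Suc n) (positive_word a @ positive_word b)
          + v_power 1 * const_v (z_power 1) *
            closure_value P (Suc n) (positive_word a @ [(i, True)] @ positive_word b)"
        using value_equiv[OF square] closure_value_square[OF assms(1) sets(1,2), of "positive_word a" "positive_word b"]
          sets by simp
      then show ?thesis using v_degree_le_add[OF ab aib] by simp
    next
      case (unused v)
      have len: "length u = length v" by (rule positive_equiv_length[OF unused(1)])
      have "closure_value P (Suc n) (positive_word u) =
          circle_factor * closure_value P n (positive_word v)"
        unfolding value_equiv[OF unused(1)]
        by (rule closure_value_add_strand[OF assms(1) Suc.hyps]) (use unused in simp)
      then show ?thesis
        using v_degree_le_mult[OF v_degree_le_circle_factor Suc.IH[OF unused(2)]] len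
        by (simp add: algebra_simps)
    next
      case (once x y)
      have len: "length u = Suc (length (y @ x))" using positive_equiv_length[OF once(1)] by simp
      have "closure_value P (Suc n) (positive_word u) = closure_value P n (positive_word (y @ x))"
        unfolding value_equiv[OF once(1)] by (rule closure_value_once[OF assms(1) Suc.hyps once(2)])
      moreover have "int (length (y @ x)) + int n - 1 \<le> int (length u) + int (Suc n) - 1"
        by (simp add: len)
      ultimately show ?thesis using v_degree_le_mono[OF Suc.IH[OF once(2)]] by simp
    qed
  qed
qed

text \<open>A top letter that occurs once makes the general bound strict by two, and an unused strand preserves
  strictness. On a single strand there are no nonempty words, so the first
  case occurs at some stage of the induction.\<close>
lemma v_degree_square_free_closure:
  assumes "homflypt P" "n \<ge> 1" "set u \<subseteq> {1..<n}" "\<not> has_square u" "u \<noteq> []"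
  shows "v_degree_le (closure_value P n (positive_word u)) (int (length u) + int n - 2)"
  using assms(2-)
proof (induction n arbitrary: u rule: nat_induct_at_least)
  case base
  then show ?case by simp
next
  case (Suc n)
  note value_equiv = closure_value_positive_equiv[OF assms(1) _ Suc.prems(1)]
  from Suc.prems(1) show ?case
  proof (cases rule: positive_word_cases)
    case (square a i b)
    with Suc.prems show ?thesis unfolding has_square_def by blast
  next
    case (unused v)
    have len: "length u = length v" by (rule positive_equiv_length[OF unused(1)])
    have "\<not> has_square v" using has_square_equiv[OF unused(1)] Suc.prems by blast
    moreover have "v \<noteq> []" using len Suc.prems by auto
    ultimately have bound: "v_degree_le (closure_value P n (positive_word v)) (int (length v) + int n - 2)"
      by (rule Suc.IH[OF unused(2)])
    have "closure_value P (Suc n) (positive_word u) =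
        circle_factor * closure_value P n (positive_word v)"
      unfolding value_equiv[OF unused(1)]
      by (rule closure_value_add_strand[OF assms(1) Suc.hyps]) (use unused in simp)
    then show ?thesis
      using v_degree_le_mult[OF v_degree_le_circle_factor bound] len
      by (simp add: algebra_simps)
  next
    case (once x y)
    have len: "length u = Suc (length (y @ x))" using positive_equiv_length[OF once(1)] by simp
    have "closure_value P (Suc n) (positive_word u) = closure_value P n (positive_word (y @ x))"
      unfolding value_equiv[OF once(1)] by (rule closure_value_once[OF assms(1) Suc.hyps once(2)])
    moreover have "int (length (y @ x)) + int n - 1 \<le> int (length u) + int (Suc n) - 2"
      by (simp add: len)
    ultimately show ?thesis
      using v_degree_le_mono[OF v_degree_positive_closure[OF assms(1) Suc.hyps once(2)]] by simp
  qed
qed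

text \<open>A square could be deleted without changing the permutation.\<close>
lemma reduced_expression_no_square:
  assumes "reduced_expression n \<alpha> js"
  shows "\<not> has_square js"
proof
  assume "has_square js"
  then obtain a i b where equiv: "positive_equiv js (a @ [i, i] @ b)"
    unfolding has_square_def by blast
  have "transposition_product js = transposition_product (a @ b)"
    unfolding positive_equiv_transposition_product[OF equiv]
    by (simp add: fun_eq_iff)
  moreover have "set (a @ b) \<subseteq> set js" using positive_equiv_set[OF equiv] by auto
  ultimately have "expression n \<alpha> (a @ b)"
    using assms by (auto simp: reduced_expression_def expression_def)
  then have "perm_length n \<alpha> \<le> length (a @ b)"
    unfolding perm_length_def by (intro Least_le) blast
  then show False
    using assms positive_equiv_length[OF equiv] by (simp add: reduced_expression_def)
qed

lemma perm_length_id: "perm_length n id = 0"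
  unfolding perm_length_def by (intro Least_eq_0 exI[of _ "[]"]) (simp add: expression_def)

theorem proposition1:
  fixes P :: "diagram \<Rightarrow> laurent"
    and n w :: nat
    and \<alpha> :: "nat \<Rightarrow> nat"
    and b :: braid_word
  assumes "homflypt P"
    and "n \<ge> 1"
    and "\<alpha> permutes {1..n}"
    and "w = perm_length n \<alpha>"
    and "b \<in> simple_braid n \<alpha>"
  shows "(max_v_degree (P (closure_diagram n b)) = Fin (int w + int n - 1) \<longleftrightarrow> \<alpha> = id)
    \<and> (\<alpha> = id \<longrightarrow> w = 0 \<and>
        v_coeff (P (closure_diagram n b)) (int w + int n - 1) = (- z_power (-1)) ^ (n - 1))"
proof -
  from assms(5) obtain js
    where js: "reduced_expression n \<alpha> js" "braid_equiv n (positive_word js) b"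
    by (auto simp: simple_braid_def positive_word_def)
  have len: "length js = w" and js_set: "set js \<subseteq> {1..<n}" and prod: "transposition_product js = \<alpha>"
    using js(1) assms(4) by (auto simp: reduced_expression_def expression_def)
  have eval: "P (closure_diagram n b) = closure_value P n (positive_word js)"
    using closure_value_braid_equiv[OF assms(1) js(2)] by (simp add: closure_value_def)
  show ?thesis
  proof (cases "\<alpha> = id")
    case True
    then have "w = 0" using assms(4) perm_length_id by simp
    with len have "js = []" by simp
    obtain m where m: "n = Suc m" using assms(2) by (cases n) auto
    have deg: "v_degree_le (P (closure_diagram n b)) (int m)"
      and coeff: "v_coeff (P (closure_diagram n b)) (int m) = (- z_power (-1)) ^ m"
      using closure_value_identity[OF assms(1), of m] by (simp_all add: eval[unfolded \<open>js = []\<close> m] m)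
    from deg have "max_v_degree (P (closure_diagram n b)) = Fin (int m)"
      by (rule max_v_degree_eqI) (simp only: coeff strand_coefficient_nonzero not_False_eq_True)
    then show ?thesis using True coeff \<open>w = 0\<close> by (simp add: m)
  next
    case False
    then have "js \<noteq> []" using prod by auto
    then have "v_degree_le (P (closure_diagram n b)) (int w + int n - 2)"
      unfolding eval len[symmetric]
      by (intro v_degree_square_free_closure assms(1,2) js_set reduced_expression_no_square[OF js(1)])
    then show ?thesis using False max_v_degree_le by fastforce
  qed
qed

end
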